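(* Let $n\ge 3$, let $J_n\in\mathcal{J}_n$ with parameters $c_1,\dots,c_{n-1}\in\mathbb{R}$, $b_1,\dots,b_n\in\mathbb{C}\setminus\{0\}$, $a_n\in\mathbb{C}$, let $\chi_n(\lambda)=\det(\lambda I_n-J_n)$, let $\mu_1<\dots<\mu_{n-1}$ be the eigenvalues of the leading principal $(n-1)\times(n-1)$ submatrix $J_{n-1}$ of $J_n$, and let $\beta=b_1b_2\cdots b_n\neq0$. Then the numbers $\chi_n(\mu_k)$ are real and: (1) if $\beta$ is nonreal, then $$(-1)^{n-k}\chi_n(\mu_k)>0\quad\text{and}\quad|\chi_n(\mu_k)+2\operatorname{Re}\beta|\ge 2|\beta|,\qquad k=1,\dots,n-1;$$ (2) if $\beta$ is real (and nonzero), then $$(-1)^{n-k}\chi_n(\mu_k)\ge0\quad\text{and}\quad|\chi_n(\mu_k)|\ge 4(-1)^{n-k-1}\beta,\qquad k=1,\dots,n-1.$$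
   Context: For $n\ge 3$, $\mathcal{J}_n$ is the class of complex $n\times n$ matrices $$J_n=\begin{pmatrix} c_1 & b_1 & 0 &\dots& 0 & \overline{b}_n\\ \overline{b}_1 & c_2 & b_2 &\dots& 0 & 0\\ 0 & \overline{b}_2 & c_3 &\dots& 0 & 0\\ \vdots&\vdots&\vdots&\ddots&\vdots&\vdots\\ 0&0&0&\dots&c_{n-1}&b_{n-1}\\ b_n&0&0&\dots&\overline{b}_{n-1}&a_n \end{pmatrix},$$ i.e. the diagonal entries are $c_1,\dots,c_{n-1},a_n$; the $(k,k+1)$ entry is $b_k$ and the $(k+1,k)$ entry is $\overline{b}_k$ for $k=1,\dots,n-1$; the $(1,n)$ entry is $\overline{b}_n$ and the $(n,1)$ entry is $b_n$; all other entries are $0$. Here $c_1,\dots,c_{n-1}\in\mathbb{R}$, $b_1,\dots,b_n\in\mathbb{C}\setminus\{0\}$, $a_n\in\mathbb{C}$. The submatrix $J_{n-1}$ is self-adjoint with real simple eigenvalues, numbered in increasing order $\mu_1<\dots<\mu_{n-1}$. *)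

theory Defs
  imports "Jordan_Normal_Form.Spectral_Radius"
begin

text \<open>
  The parameters c and b are indexed from 1 as in the mathematical text, whereas the rows and
  columns of a matrix are indexed from 0; hence the shifts below.  The band and corner
  conditions are pairwise disjoint only for n at least 3.
\<close>

definition periodic_jacobi_mat ::
  "nat \<Rightarrow> (nat \<Rightarrow> real) \<Rightarrow> (nat \<Rightarrow> complex) \<Rightarrow> complex \<Rightarrow> complex mat" where
  "periodic_jacobi_mat n c b a = mat n n (\<lambda>(i, j).
     if i = j then (if i = n - 1 then a else complex_of_real (c (i + 1)))
     else if j = i + 1 then b (i + 1)
     else if i = j + 1 then cnj (b (j + 1))
     else if i = 0 \<and> j = n - 1 then cnj (b n)
     else if i = n - 1 \<and> j = 0 then b n
     else 0)"

definition leading_principal_submatrix :: "nat \<Rightarrow> 'a mat \<Rightarrow> 'a mat" where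
  "leading_principal_submatrix m A = mat m m (\<lambda>(i, j). A $$ (i, j))"

end

theory Submission imports Defs begin

text \<open>
  Write \<open>J\<close> as its leading tridiagonal block bordered by one row and one column.  Expanding
  \<open>det (x - J)\<close> along the border gives \<open>x - a\<close> times the characteristic polynomial of the block,
  minus a sum over the border entries weighted by cofactors of the block
  (\<open>det_bordered\<close>).  The border has only two nonzero entries on each side, so only the
  four corner cofactors occur, and at an eigenvalue \<open>\<mu> k\<close> of the block the term with \<open>a\<close> vanishes:
  \<open>\<chi> (\<mu> k) = - (y + z + 2 Re \<beta>)\<close>.  Here \<open>y\<close> and \<open>z\<close> are the principal minors obtained by
  deleting the last or the first row and column of the block, times \<open>|b (n - 1)|\<^sup>2\<close> and
  \<open>|b n|\<^sup>2\<close>, and \<open>2 Re \<beta>\<close> comes from the two remaining corners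
  (\<open>periodic_jacobi_char_value\<close>).  In particular the value is real.

  Two facts about \<open>y\<close> and \<open>z\<close> give everything else.  First, \<open>y * z = |\<beta>|\<^sup>2\<close>: both minors solve
  the three-term recurrence of the block, and their Casoratian is the product of the weights
  \<open>|b i|\<^sup>2\<close> for \<open>i \<le> n - 2\<close> (\<open>jacobi_poly_casoratian\<close>).  Second, \<open>y\<close> has the sign \<open>s = (-1) ^ (n - k - 1)\<close>: the
  Wronskian of consecutive recurrence polynomials is positive, so at \<open>\<mu> k\<close> the minor has the sign of
  the derivative of the characteristic polynomial of the block
  (\<open>jacobi_poly_wronskian_pos\<close>), and that polynomial has as many distinct roots as its degree
  (\<open>pderiv_sign_at_simple_roots\<close>).

  Hence \<open>y\<close> and \<open>z\<close> both have sign \<open>s\<close>, and the arithmetic-geometric mean inequality yields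
  \<open>s * (y + z) \<ge> 2 |\<beta>|\<close>.  This is the bound on \<open>\<chi> (\<mu> k) + 2 Re \<beta>\<close>, and it gives
  \<open>- s * \<chi> (\<mu> k) \<ge> 2 |\<beta>| + 2 s * Re \<beta>\<close>.  The right-hand side is nonnegative, positive for nonreal
  \<open>\<beta>\<close>, and at least \<open>4 s * Re \<beta>\<close>.
\<close>

section \<open>Bordered and tridiagonal determinants\<close>

text \<open>Expand along the last row, and then expand each remaining minor along its last column,
  which is the border column; what is left are the minors of the leading block.  The sign of the
  second expansion is one position short of that of the cofactor, hence the minus.\<close>

lemma det_bordered:
  fixes A :: "'a :: comm_ring_1 mat"
  assumes A: "A \<in> carrier_mat (Suc m) (Suc m)"
  defines "M \<equiv> leading_principal_submatrix m A"
  shows "det A = A $$ (m, m) * det M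
    - (\<Sum>j<m. \<Sum>i<m. A $$ (m, j) * A $$ (i, m) * cofactor M i j)"
proof -
  have minor: "A $$ (m, j) * cofactor A m j
      = - (\<Sum>i<m. A $$ (m, j) * A $$ (i, m) * cofactor M i j)" if j: "j < m" for j
  proof -
    obtain l where l: "m = Suc l" using j by (cases m) auto
    have D: "mat_delete A m j \<in> carrier_mat m m"
      using mat_delete_carrier[OF A] by simp
    have "det (mat_delete A m j)
        = (\<Sum>i<m. mat_delete A m j $$ (i, l) * cofactor (mat_delete A m j) i l)"
      by (rule laplace_expansion_column[OF D]) (simp add: l)
    also have "\<dots> = (\<Sum>i<m. A $$ (i, m) * ((-1) ^ (i + l) * det (mat_delete M i j)))"
    proof (rule sum.cong[OF refl])
      fix i assume i: "i \<in> {..<m}"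
      have "mat_delete (mat_delete A m j) i l = mat_delete M i j"
        using A i j l by (intro eq_matI) (auto simp: mat_delete_def M_def leading_principal_submatrix_def)
      moreover have "mat_delete A m j $$ (i, l) = A $$ (i, m)"
        using A i j l by (auto simp: mat_delete_def)
      ultimately show "mat_delete A m j $$ (i, l) * cofactor (mat_delete A m j) i l
          = A $$ (i, m) * ((-1) ^ (i + l) * det (mat_delete M i j))"
        by (simp add: cofactor_def)
    qed
    finally have "A $$ (m, j) * cofactor A m j
        = (\<Sum>i<m. A $$ (m, j) * ((-1) ^ (m + j) *
            (A $$ (i, m) * ((-1) ^ (i + l) * det (mat_delete M i j)))))"
      by (simp add: cofactor_def sum_distrib_left)
    also have "\<dots> = (\<Sum>i<m. - (A $$ (m, j) * A $$ (i, m) * cofactor M i j))"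
    proof (rule sum.cong[OF refl])
      fix i
      have sign: "(-1) ^ (m + j) * (-1) ^ (i + l) = (- ((-1) ^ (i + j)) :: 'a)"
      proof -
        have "(-1) ^ (m + j) * (-1) ^ (i + l) = ((-1) ^ (Suc (2 * l + (i + j))) :: 'a)"
          by (simp add: l power_add[symmetric] mult_2 mult_2_right ac_simps)
        then show ?thesis by (simp add: power_add)
      qed
      have "A $$ (m, j) * ((-1) ^ (m + j) *
            (A $$ (i, m) * ((-1) ^ (i + l) * det (mat_delete M i j))))
          = A $$ (m, j) * A $$ (i, m) * (((-1) ^ (m + j) * (-1) ^ (i + l)) * det (mat_delete M i j))"
        by (simp only: mult_ac)
      then show "A $$ (m, j) * ((-1) ^ (m + j) *
            (A $$ (i, m) * ((-1) ^ (i + l) * det (mat_delete M i j))))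
          = - (A $$ (m, j) * A $$ (i, m) * cofactor M i j)"
        unfolding sign by (simp add: cofactor_def)
    qed
    finally show ?thesis by (simp add: sum_negf)
  qed
  have last: "cofactor A m m = det M"
  proof -
    have "mat_delete A m m = M"
      using A by (intro eq_matI) (auto simp: mat_delete_def M_def leading_principal_submatrix_def)
    then show ?thesis by (simp add: cofactor_def power_add[symmetric] mult_2[symmetric])
  qed
  have "det A = (\<Sum>j<m. A $$ (m, j) * cofactor A m j) + A $$ (m, m) * cofactor A m m"
    using laplace_expansion_row[OF A, of m] by simp
  then show ?thesis
    by (simp add: minor last sum_negf)
qed

definition tridiagonal_mat ::
  "nat \<Rightarrow> (nat \<Rightarrow> 'a) \<Rightarrow> (nat \<Rightarrow> 'a) \<Rightarrow> (nat \<Rightarrow> 'a) \<Rightarrow> 'a :: zero mat" where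
  "tridiagonal_mat m d u l = mat m m (\<lambda>(i, j).
     if i = j then d i else if j = Suc i then u i else if i = Suc j then l j else 0)"

lemma tridiagonal_carrier [simp]: "tridiagonal_mat m d u l \<in> carrier_mat m m"
  by (simp add: tridiagonal_mat_def)

lemma cofactor_tridiagonal_last:
  "cofactor (tridiagonal_mat (Suc m) d u l) m m = det (tridiagonal_mat m d u l)"
proof -
  have "mat_delete (tridiagonal_mat (Suc m) d u l) m m = tridiagonal_mat m d u l"
    by (intro eq_matI) (auto simp: mat_delete_def tridiagonal_mat_def)
  then show ?thesis by (simp add: cofactor_def power_add[symmetric] mult_2[symmetric])
qed

lemma cofactor_tridiagonal_first:
  "cofactor (tridiagonal_mat (Suc m) d u l) 0 0
    = det (tridiagonal_mat m (\<lambda>i. d (Suc i)) (\<lambda>i. u (Suc i)) (\<lambda>i. l (Suc i)))"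
proof -
  have "mat_delete (tridiagonal_mat (Suc m) d u l) 0 0
      = tridiagonal_mat m (\<lambda>i. d (Suc i)) (\<lambda>i. u (Suc i)) (\<lambda>i. l (Suc i))"
    by (intro eq_matI) (auto simp: mat_delete_def tridiagonal_mat_def)
  then show ?thesis by (simp add: cofactor_def)
qed

text \<open>Deleting the last row and the first column leaves a lower triangular matrix whose diagonal
  is the superdiagonal of the original one; the sign of the cofactor negates each entry.\<close>

lemma cofactor_tridiagonal_bottom_left:
  "cofactor (tridiagonal_mat (Suc m) d u l) m 0 = (\<Prod>i<m. - u i)"
proof -
  let ?D = "mat_delete (tridiagonal_mat (Suc m) d u l) m 0"
  have D: "?D \<in> carrier_mat m m" by (simp add: tridiagonal_mat_def mat_delete_def)
  have "det ?D = prod_list (diag_mat ?D)"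
    by (rule det_lower_triangular[OF _ D]) (auto simp: mat_delete_def tridiagonal_mat_def)
  also have "\<dots> = (\<Prod>i<m. u i)"
    unfolding prod_list_diag_prod
    by (rule prod.cong) (auto simp: mat_delete_def tridiagonal_mat_def)
  finally show ?thesis by (simp add: cofactor_def prod_uminus)
qed

text \<open>The mirror image: the remaining matrix is upper triangular, with the subdiagonal on its
  diagonal.\<close>

lemma cofactor_tridiagonal_top_right:
  "cofactor (tridiagonal_mat (Suc m) d u l) 0 m = (\<Prod>i<m. - l i)"
proof -
  let ?D = "mat_delete (tridiagonal_mat (Suc m) d u l) 0 m"
  have D: "?D \<in> carrier_mat m m" by (simp add: tridiagonal_mat_def mat_delete_def)
  have "det ?D = prod_list (diag_mat ?D)"
    by (rule det_upper_triangular[OF _ D]) (auto simp: mat_delete_def tridiagonal_mat_def)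
  also have "\<dots> = (\<Prod>i<m. l i)"
    unfolding prod_list_diag_prod
    by (rule prod.cong) (auto simp: mat_delete_def tridiagonal_mat_def)
  finally show ?thesis by (simp add: cofactor_def prod_uminus)
qed

lemma det_tridiagonal_Suc_Suc:
  "det (tridiagonal_mat (Suc (Suc m)) d u l)
    = d (Suc m) * det (tridiagonal_mat (Suc m) d u l)
      - u m * l m * det (tridiagonal_mat m d u l)"
proof -
  let ?A = "tridiagonal_mat (Suc (Suc m)) d u l"
  have M: "leading_principal_submatrix (Suc m) ?A = tridiagonal_mat (Suc m) d u l"
    by (intro eq_matI) (auto simp: leading_principal_submatrix_def tridiagonal_mat_def)
  have zero: "?A $$ (Suc m, j) = 0" "?A $$ (j, Suc m) = 0" if "j < m" for j
    using that by (auto simp: tridiagonal_mat_def)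
  have border: "?A $$ (Suc m, Suc m) = d (Suc m)" "?A $$ (Suc m, m) = l m" "?A $$ (m, Suc m) = u m"
    by (auto simp: tridiagonal_mat_def)
  show ?thesis
    unfolding det_bordered[OF tridiagonal_carrier] M
    by (simp add: zero border cofactor_tridiagonal_last algebra_simps)
qed

text \<open>Only the first and last entries of the border column \<open>s\<close> and border row \<open>r\<close> survive, so
  just the four corner cofactors of the tridiagonal block enter.\<close>

lemma det_periodic_tridiagonal:
  fixes A :: "'a :: comm_ring_1 mat"
  assumes A: "A \<in> carrier_mat (Suc (Suc (Suc m))) (Suc (Suc (Suc m)))"
    and block: "leading_principal_submatrix (Suc (Suc m)) A = tridiagonal_mat (Suc (Suc m)) d u l"
    and row: "A $$ (Suc (Suc m), 0) = r\<^sub>0" "A $$ (Suc (Suc m), Suc m) = r\<^sub>1"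
      "\<And>j. 0 < j \<Longrightarrow> j \<le> m \<Longrightarrow> A $$ (Suc (Suc m), j) = 0"
    and col: "A $$ (0, Suc (Suc m)) = s\<^sub>0" "A $$ (Suc m, Suc (Suc m)) = s\<^sub>1"
      "\<And>i. 0 < i \<Longrightarrow> i \<le> m \<Longrightarrow> A $$ (i, Suc (Suc m)) = 0"
  shows "det A = A $$ (Suc (Suc m), Suc (Suc m)) * det (tridiagonal_mat (Suc (Suc m)) d u l)
    - (r\<^sub>0 * s\<^sub>0 * det (tridiagonal_mat (Suc m) (\<lambda>i. d (Suc i)) (\<lambda>i. u (Suc i)) (\<lambda>i. l (Suc i)))
      + r\<^sub>0 * s\<^sub>1 * (\<Prod>i<Suc m. - u i)
      + r\<^sub>1 * s\<^sub>0 * (\<Prod>i<Suc m. - l i)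
      + r\<^sub>1 * s\<^sub>1 * det (tridiagonal_mat (Suc m) d u l))"
proof -
  have ends: "(\<Sum>i<Suc (Suc m). f i) = f 0 + f (Suc m)"
    if "\<And>i. 0 < i \<Longrightarrow> i \<le> m \<Longrightarrow> f i = 0" for f :: "nat \<Rightarrow> 'a"
  proof -
    have "(\<Sum>i<m. f (Suc i)) = 0" using that by (intro sum.neutral) auto
    then show ?thesis by (subst sum.lessThan_Suc, subst sum.lessThan_Suc_shift) simp
  qed
  have inner: "(\<Sum>i<Suc (Suc m). A $$ (Suc (Suc m), j) * A $$ (i, Suc (Suc m)) * g i)
      = A $$ (Suc (Suc m), j) * (s\<^sub>0 * g 0 + s\<^sub>1 * g (Suc m))" for j and g :: "nat \<Rightarrow> 'a"
    by (subst ends) (auto simp: col algebra_simps)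
  show ?thesis
    unfolding det_bordered[OF A] block inner
    by (subst ends)
       (auto simp: row cofactor_tridiagonal_first cofactor_tridiagonal_last
          cofactor_tridiagonal_bottom_left cofactor_tridiagonal_top_right algebra_simps
        simp del: prod.lessThan_Suc)
qed

section \<open>The polynomials of the three-term recurrence\<close>

text \<open>The polynomial \<open>jacobi_poly d w m\<close> is the characteristic polynomial of the Hermitian
  tridiagonal matrix of size \<open>m\<close> with diagonal \<open>d\<close> and squared off-diagonal moduli \<open>w\<close>.\<close>

fun jacobi_poly :: "(nat \<Rightarrow> real) \<Rightarrow> (nat \<Rightarrow> real) \<Rightarrow> nat \<Rightarrow> real poly" where
  "jacobi_poly d w 0 = 1"
| "jacobi_poly d w (Suc 0) = [:- d 0, 1:]"
| "jacobi_poly d w (Suc (Suc m))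
    = [:- d (Suc m), 1:] * jacobi_poly d w (Suc m) - Polynomial.smult (w m) (jacobi_poly d w m)"

lemma det_tridiagonal_eq_jacobi_poly:
  assumes d: "\<And>i. i < m \<Longrightarrow> D i = complex_of_real (x - d i)"
    and w: "\<And>i. Suc i < m \<Longrightarrow> u i * l i = complex_of_real (w i)"
  shows "det (tridiagonal_mat m D u l) = complex_of_real (poly (jacobi_poly d w m) x)"
  using assms
proof (induction d w m rule: jacobi_poly.induct)
  case (1 d w)
  then show ?case by simp
next
  case (2 d w)
  then show ?case by (subst det_single) (auto simp: tridiagonal_mat_def)
next
  case (3 d w m)
  have coeffs: "D (Suc m) = complex_of_real (x - d (Suc m))" "u m * l m = complex_of_real (w m)"
    using 3 by simp_all
  have IH: "det (tridiagonal_mat (Suc m) D u l) = complex_of_real (poly (jacobi_poly d w (Suc m)) x)"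
    "det (tridiagonal_mat m D u l) = complex_of_real (poly (jacobi_poly d w m) x)"
    using 3 by simp_all
  show ?case
    unfolding det_tridiagonal_Suc_Suc coeffs IH by (simp add: algebra_simps)
qed

lemma jacobi_poly_monic: "degree (jacobi_poly d w m) = m \<and> Polynomial.coeff (jacobi_poly d w m) m = 1"
proof (induction d w m rule: jacobi_poly.induct)
  case (3 d w m)
  let ?p = "jacobi_poly d w (Suc m)" and ?q = "jacobi_poly d w m"
  have "?p \<noteq> 0" using 3 by auto
  then have deg: "degree ([:- d (Suc m), 1:] * ?p) = Suc (Suc m)"
    using 3 by (subst degree_mult_eq) auto
  moreover have "degree (Polynomial.smult (w m) ?q) < Suc (Suc m)"
    using 3 degree_smult_le[of "w m" ?q] by linarith
  moreover have "Polynomial.coeff ?q (Suc (Suc m)) = 0"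
    using 3 by (simp add: coeff_eq_0)
  moreover have "Polynomial.coeff ([:- d (Suc m), 1:] * ?p) (Suc (Suc m)) = 1"
    using 3 coeff_eq_0[of ?p "Suc (Suc m)"] by (simp add: coeff_pCons)
  ultimately show ?case
    by (simp add: diff_conv_add_uminus degree_add_eq_left del: add_uminus_conv_diff)
qed auto

text \<open>The left-hand side is the Casoratian of two solutions of the same recurrence, so each step
  multiplies it by the next weight.  At a root of the polynomial of degree \<open>m + 2\<close> only the first
  product remains: there the two corner minors, with the last or the first row and column deleted,
  multiply to the product of all weights.\<close>

lemma jacobi_poly_casoratian:
  "poly (jacobi_poly d w (Suc m)) x
      * poly (jacobi_poly (\<lambda>i. d (Suc i)) (\<lambda>i. w (Suc i)) (Suc m)) x
    - poly (jacobi_poly d w (Suc (Suc m))) x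
      * poly (jacobi_poly (\<lambda>i. d (Suc i)) (\<lambda>i. w (Suc i)) m) x
    = (\<Prod>i<Suc m. w i)"
proof (induction m)
  case 0
  then show ?case by (simp add: algebra_simps)
next
  case (Suc m)
  let ?p = "\<lambda>k. poly (jacobi_poly d w k) x"
  let ?q = "\<lambda>k. poly (jacobi_poly (\<lambda>i. d (Suc i)) (\<lambda>i. w (Suc i)) k) x"
  have p: "?p (Suc (Suc (Suc m))) = (x - d (Suc (Suc m))) * ?p (Suc (Suc m)) - w (Suc m) * ?p (Suc m)"
    by (subst jacobi_poly.simps(3)) (simp add: algebra_simps del: jacobi_poly.simps)
  have q: "?q (Suc (Suc m)) = (x - d (Suc (Suc m))) * ?q (Suc m) - w (Suc m) * ?q m"
    by (subst jacobi_poly.simps(3)) (simp add: algebra_simps del: jacobi_poly.simps)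
  have "?p (Suc (Suc m)) * ?q (Suc (Suc m)) - ?p (Suc (Suc (Suc m))) * ?q (Suc m)
      = w (Suc m) * (?p (Suc m) * ?q (Suc m) - ?p (Suc (Suc m)) * ?q m)"
    unfolding p q by (simp add: algebra_simps del: jacobi_poly.simps)
  also have "\<dots> = w (Suc m) * (\<Prod>i<Suc m. w i)"
    by (simp only: Suc.IH)
  finally show ?case
    by (simp del: jacobi_poly.simps)
qed

text \<open>The confluent Christoffel-Darboux formula: the Wronskian \<open>W\<close> of consecutive polynomials obeys
  \<open>W (m + 1) = p (m + 1)\<^sup>2 + w m * W m\<close>, so it stays positive.\<close>

lemma jacobi_poly_wronskian_pos:
  assumes "\<And>i. i < m \<Longrightarrow> w i > 0"
  shows "poly (pderiv (jacobi_poly d w (Suc m))) x * poly (jacobi_poly d w m) x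
    - poly (jacobi_poly d w (Suc m)) x * poly (pderiv (jacobi_poly d w m)) x > 0"
  using assms
proof (induction m)
  case 0
  then show ?case by (simp add: pderiv_pCons)
next
  case (Suc m)
  let ?p = "\<lambda>k. poly (jacobi_poly d w k) x"
  let ?p' = "\<lambda>k. poly (pderiv (jacobi_poly d w k)) x"
  have W: "?p' (Suc m) * ?p m - ?p (Suc m) * ?p' m > 0"
    using Suc by simp
  have p: "?p (Suc (Suc m)) = (x - d (Suc m)) * ?p (Suc m) - w m * ?p m"
    by (simp add: algebra_simps)
  have p': "?p' (Suc (Suc m)) = ?p (Suc m) + (x - d (Suc m)) * ?p' (Suc m) - w m * ?p' m"
    by (subst jacobi_poly.simps(3))
       (simp only: pderiv_diff pderiv_mult pderiv_smult pderiv_pCons,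
         simp add: algebra_simps del: jacobi_poly.simps)
  have "?p' (Suc (Suc m)) * ?p (Suc m) - ?p (Suc (Suc m)) * ?p' (Suc m)
      = (?p (Suc m))\<^sup>2 + w m * (?p' (Suc m) * ?p m - ?p (Suc m) * ?p' m)"
    unfolding p p' by (simp add: algebra_simps power2_eq_square del: jacobi_poly.simps)
  also have "\<dots> > 0"
    using W Suc.prems[of m] by (intro add_nonneg_pos mult_pos_pos) auto
  finally show ?case .
qed

text \<open>Having as many roots as its degree allows, \<open>p\<close> is the product of its linear factors; the
  derivative at \<open>\<mu> k\<close> is the product of the differences to the other roots, of which the \<open>m - k\<close>
  larger ones contribute a negative factor.\<close>

lemma pderiv_sign_at_simple_roots:
  fixes p :: "real poly"
  assumes p: "degree p = m" "Polynomial.coeff p m = 1"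
    and inc: "strict_mono_on {1..m} \<mu>"
    and root: "\<And>k. k \<in> {1..m} \<Longrightarrow> poly p (\<mu> k) = 0"
    and k: "k \<in> {1..m}"
  shows "(-1) ^ (m - k) * poly (pderiv p) (\<mu> k) > 0"
proof -
  let ?f = "\<lambda>j. [:- \<mu> j, 1:]"
  have less: "\<mu> i < \<mu> j" if "i \<in> {1..m}" "j \<in> {1..m}" "i < j" for i j
    using inc that by (simp add: strict_mono_on_def)
  have inj: "inj_on \<mu> {1..m}"
    using inc by (rule strict_mono_on_imp_inj_on)
  have deg: "degree (\<Prod>j=1..m. ?f j) = m"
    by (subst degree_prod_eq_sum_degree) auto
  have lead: "Polynomial.coeff (\<Prod>j=1..m. ?f j) m = 1"
    using lead_coeff_prod[of ?f "{1..m}"] unfolding deg by simp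
  have card: "card (\<mu> ` {1..m}) = m"
    using card_image[OF inj] by simp
  have root': "poly (\<Prod>j=1..m. ?f j) (\<mu> i) = 0" if "i \<in> {1..m}" for i
    using that by (auto simp: poly_prod intro!: bexI[of _ i])
  have "p = (\<Prod>j=1..m. ?f j)"
    by (rule poly_eqI_degree_lead_coeff[where n = m and A = "\<mu> ` {1..m}"])
       (use p deg lead root root' card in auto)
  also have "\<dots> = ?f k * (\<Prod>j\<in>{1..m}-{k}. ?f j)"
    using k by (simp add: prod.remove)
  finally have factor: "p = ?f k * (\<Prod>j\<in>{1..m}-{k}. ?f j)" .
  have "poly (pderiv p) (\<mu> k) = (\<Prod>j\<in>{1..m}-{k}. \<mu> k - \<mu> j)"
    unfolding factor pderiv_mult poly_add poly_mult poly_prod by (simp add: pderiv_pCons)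
  also have "{1..m} - {k} = {1..<k} \<union> {k<..m}"
    using k by auto
  also have "(\<Prod>j\<in>{1..<k} \<union> {k<..m}. \<mu> k - \<mu> j)
      = (\<Prod>j\<in>{1..<k}. \<mu> k - \<mu> j) * (\<Prod>j\<in>{k<..m}. - (\<mu> j - \<mu> k))"
    by (subst prod.union_disjoint) auto
  also have "\<dots> = (\<Prod>j\<in>{1..<k}. \<mu> k - \<mu> j) * ((-1) ^ (m - k) * (\<Prod>j\<in>{k<..m}. \<mu> j - \<mu> k))"
    by (subst prod_uminus) simp
  finally have deriv: "poly (pderiv p) (\<mu> k)
      = (\<Prod>j\<in>{1..<k}. \<mu> k - \<mu> j) * ((-1) ^ (m - k) * (\<Prod>j\<in>{k<..m}. \<mu> j - \<mu> k))" .
  have "(-1) ^ (m - k) * poly (pderiv p) (\<mu> k)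
      = (\<Prod>j\<in>{1..<k}. \<mu> k - \<mu> j) * (\<Prod>j\<in>{k<..m}. \<mu> j - \<mu> k)"
    unfolding deriv by (subst mult.left_commute) simp
  also have "\<dots> > 0"
    using k less by (intro mult_pos_pos prod_pos) auto
  finally show ?thesis .
qed

text \<open>Interlacing in the form of signs: at a root of the next polynomial the Wronskian reduces to
  the derivative times \<open>jacobi_poly d w m\<close>, so these two have the same sign.\<close>

corollary jacobi_poly_sign_at_next_roots:
  assumes w: "\<And>i. i < m \<Longrightarrow> w i > 0"
    and inc: "strict_mono_on {1..Suc m} \<mu>"
    and root: "\<And>k. k \<in> {1..Suc m} \<Longrightarrow> poly (jacobi_poly d w (Suc m)) (\<mu> k) = 0"
    and k: "k \<in> {1..Suc m}"
  shows "(-1) ^ (Suc m - k) * poly (jacobi_poly d w m) (\<mu> k) > 0"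
proof -
  let ?s = "(-1) ^ (Suc m - k) :: real"
  let ?P = "poly (jacobi_poly d w m) (\<mu> k)"
  let ?D = "poly (pderiv (jacobi_poly d w (Suc m))) (\<mu> k)"
  have "?s * ?D > 0"
    using pderiv_sign_at_simple_roots[OF _ _ inc root k] jacobi_poly_monic[of d w "Suc m"] by blast
  moreover have "?D * ?P > 0"
    using jacobi_poly_wronskian_pos[of m w d "\<mu> k", OF w] root[OF k] by simp
  moreover have "?s = 1 \<or> ?s = -1"
    by (cases "even (Suc m - k)") auto
  ultimately show ?thesis
    by (auto simp: zero_less_mult_iff)
qed

section \<open>The characteristic polynomial at the eigenvalues of the block\<close>

text \<open>The two corner cofactors that join opposite ends of the block are products of
  off-diagonal entries; with the border entries they close the cycle to the product of all
  \<open>b k\<close> and to its conjugate, which add up to twice the real part.  The other two are values of the recurrence polynomials.\<close>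

lemma periodic_jacobi_char_value:
  fixes c :: "nat \<Rightarrow> real" and b :: "nat \<Rightarrow> complex" and a :: complex and x :: real
  assumes n: "n = Suc (Suc (Suc m))"
  defines "d \<equiv> \<lambda>i. c (Suc i)" and "w \<equiv> \<lambda>i. (cmod (b (Suc i)))\<^sup>2"
  shows "det (complex_of_real x \<cdot>\<^sub>m 1\<^sub>m n - periodic_jacobi_mat n c b a)
    = (x - a) * complex_of_real (poly (jacobi_poly d w (Suc (Suc m))) x)
      - complex_of_real (
          w (Suc (Suc m)) * poly (jacobi_poly (\<lambda>i. d (Suc i)) (\<lambda>i. w (Suc i)) (Suc m)) x
          + w (Suc m) * poly (jacobi_poly d w (Suc m)) x
          + 2 * Re (\<Prod>k=1..n. b k))"
proof -
  let ?A = "complex_of_real x \<cdot>\<^sub>m 1\<^sub>m n - periodic_jacobi_mat n c b a"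
  let ?D = "\<lambda>i. complex_of_real (x - d i)"
  let ?u = "\<lambda>i. - b (Suc i)" and ?l = "\<lambda>i. - cnj (b (Suc i))"
  have norm: "b i * cnj (b i) = complex_of_real ((cmod (b i))\<^sup>2)"
    and norm': "cnj (b i) * b i = complex_of_real ((cmod (b i))\<^sup>2)" for i
    by (simp_all only: complex_norm_square mult.commute)
  have A: "?A \<in> carrier_mat (Suc (Suc (Suc m))) (Suc (Suc (Suc m)))"
    by (simp add: n periodic_jacobi_mat_def minus_carrier_mat)
  have block: "leading_principal_submatrix (Suc (Suc m)) ?A = tridiagonal_mat (Suc (Suc m)) ?D ?u ?l"
    by (intro eq_matI)
       (auto simp: leading_principal_submatrix_def tridiagonal_mat_def periodic_jacobi_mat_def n d_def)
  define B where "B = (\<Prod>k<Suc m. b (Suc k))"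
  have \<beta>: "(\<Prod>k=1..n. b k) = B * b (Suc (Suc m)) * b n"
  proof -
    have "{1..n} = Suc ` {..<n}" by (simp add: image_Suc_lessThan)
    then have "(\<Prod>k=1..n. b k) = (\<Prod>k<n. b (Suc k))"
      by (simp add: prod.reindex)
    then show ?thesis unfolding n B_def by (simp add: mult.assoc)
  qed
  have det: "det ?A = (x - a) * det (tridiagonal_mat (Suc (Suc m)) ?D ?u ?l)
      - (- b n * - cnj (b n)
          * det (tridiagonal_mat (Suc m) (\<lambda>i. ?D (Suc i)) (\<lambda>i. ?u (Suc i)) (\<lambda>i. ?l (Suc i)))
        + - b n * - b (Suc (Suc m)) * (\<Prod>i<Suc m. - ?u i)
        + - cnj (b (Suc (Suc m))) * - cnj (b n) * (\<Prod>i<Suc m. - ?l i)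
        + - cnj (b (Suc (Suc m))) * - b (Suc (Suc m)) * det (tridiagonal_mat (Suc m) ?D ?u ?l))"
  proof -
    have corner: "?A $$ (Suc (Suc m), Suc (Suc m)) = x - a"
      by (simp add: n periodic_jacobi_mat_def)
    show ?thesis
      unfolding corner[symmetric]
      by (rule det_periodic_tridiagonal[OF A block]) (auto simp: n periodic_jacobi_mat_def)
  qed
  have D: "det (tridiagonal_mat k ?D ?u ?l) = complex_of_real (poly (jacobi_poly d w k) x)" for k
    by (rule det_tridiagonal_eq_jacobi_poly) (simp_all add: norm w_def)
  have D': "det (tridiagonal_mat k (\<lambda>i. ?D (Suc i)) (\<lambda>i. ?u (Suc i)) (\<lambda>i. ?l (Suc i)))
      = complex_of_real (poly (jacobi_poly (\<lambda>i. d (Suc i)) (\<lambda>i. w (Suc i)) k) x)" for k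
    by (rule det_tridiagonal_eq_jacobi_poly) (simp_all add: norm w_def)
  have prods: "(\<Prod>i<Suc m. - ?u i) = B" "(\<Prod>i<Suc m. - ?l i) = cnj B"
    by (simp_all add: B_def)
  have cross: "- b n * - b (Suc (Suc m)) * B + - cnj (b (Suc (Suc m))) * - cnj (b n) * cnj B
      = complex_of_real (2 * Re (\<Prod>k=1..n. b k))"
    unfolding \<beta> complex_add_cnj[symmetric] by (simp add: mult_ac)
  have w1: "- b n * - cnj (b n) = complex_of_real (w (Suc (Suc m)))"
    "- cnj (b (Suc (Suc m))) * - b (Suc (Suc m)) = complex_of_real (w (Suc m))"
    by (simp_all add: norm norm' w_def n)
  show ?thesis
    unfolding det D D' prods w1 of_real_add cross[symmetric]
    by (simp only: of_real_mult add_ac)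
qed

lemma block_eigenvalue_root:
  fixes c :: "nat \<Rightarrow> real" and b :: "nat \<Rightarrow> complex" and x :: real
  assumes n: "n = Suc m"
    and ev: "complex_of_real x \<in> spectrum (leading_principal_submatrix m (periodic_jacobi_mat n c b a))"
  shows "poly (jacobi_poly (\<lambda>i. c (Suc i)) (\<lambda>i. (cmod (b (Suc i)))\<^sup>2) m) x = 0"
proof -
  let ?M = "leading_principal_submatrix m (periodic_jacobi_mat n c b a)"
  let ?T = "tridiagonal_mat m (\<lambda>i. complex_of_real (x - c (Suc i)))
    (\<lambda>i. - b (Suc i)) (\<lambda>i. - cnj (b (Suc i)))"
  have M: "?M \<in> carrier_mat m m" by (simp add: leading_principal_submatrix_def)
  have "- char_matrix ?M x = ?T"
    by (intro eq_matI)
       (auto simp: char_matrix_def leading_principal_submatrix_def periodic_jacobi_mat_def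
          tridiagonal_mat_def n)
  moreover have "det (char_matrix ?M x) = 0"
    using ev eigenvalue_det[OF M] by (simp add: spectrum_def)
  ultimately have "det ?T = 0"
    using det_0_negate[of "char_matrix ?M x" m] M by simp
  moreover have "det ?T
      = complex_of_real (poly (jacobi_poly (\<lambda>i. c (Suc i)) (\<lambda>i. (cmod (b (Suc i)))\<^sup>2) m) x)"
    by (rule det_tridiagonal_eq_jacobi_poly) (simp_all add: complex_norm_square[symmetric])
  ultimately show ?thesis by simp
qed

text \<open>The arithmetic-geometric mean inequality for two numbers of the common sign \<open>s\<close>.\<close>

lemma two_mult_le_add_of_prod_eq:
  fixes s y z r :: real
  assumes s: "s = 1 \<or> s = -1" and y: "s * y > 0" and yz: "y * z = r\<^sup>2" and r: "r > 0"
  shows "2 * r \<le> s * (y + z)"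
proof -
  have "s * s = 1" using s by auto
  have prod: "(s * y) * (s * z) = r\<^sup>2"
    using s yz by auto
  then have sz: "s * z > 0"
    using y r by (metis zero_less_mult_pos zero_less_power)
  have sq: "(2 * r)\<^sup>2 \<le> (s * y + s * z)\<^sup>2"
  proof -
    have "(s * y + s * z)\<^sup>2 - (2 * r)\<^sup>2 = (s * y - s * z)\<^sup>2"
      using prod by (simp add: power2_eq_square algebra_simps)
    then show ?thesis by (metis diff_ge_0_iff_ge zero_le_power2)
  qed
  have "2 * r \<le> s * y + s * z"
    by (rule power2_le_imp_le[OF sq]) (use y sz in linarith)
  then show ?thesis by (simp add: distrib_left)
qed

section \<open>Signs and bounds\<close>

theorem theorem3p4:
  fixes n :: nat and c :: "nat \<Rightarrow> real" and b :: "nat \<Rightarrow> complex" and a \<beta> :: complex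
    and J :: "complex mat" and \<chi> :: "complex \<Rightarrow> complex" and \<mu> :: "nat \<Rightarrow> real"
  assumes n: "n \<ge> 3"
    and b: "\<And>k. k \<in> {1..n} \<Longrightarrow> b k \<noteq> 0"
    and J: "J = periodic_jacobi_mat n c b a"
    and \<chi>: "\<And>z. \<chi> z = det (z \<cdot>\<^sub>m 1\<^sub>m n - J)"
    and \<mu>_increasing: "strict_mono_on {1..n-1} \<mu>"
    and \<mu>_eigenvalues:
      "spectrum (leading_principal_submatrix (n - 1) J) = (\<lambda>k. complex_of_real (\<mu> k)) ` {1..n-1}"
    and \<beta>: "\<beta> = (\<Prod>k=1..n. b k)"
  shows "(\<forall>k\<in>{1..n-1}. \<chi> (\<mu> k) \<in> \<real>)
    \<and> (\<beta> \<notin> \<real> \<longrightarrow> (\<forall>k\<in>{1..n-1}.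
          (-1) ^ (n - k) * Re (\<chi> (\<mu> k)) > 0
          \<and> cmod (\<chi> (\<mu> k) + 2 * Re \<beta>) \<ge> 2 * cmod \<beta>))
    \<and> (\<beta> \<in> \<real> \<longrightarrow> (\<forall>k\<in>{1..n-1}.
          (-1) ^ (n - k) * Re (\<chi> (\<mu> k)) \<ge> 0
          \<and> cmod (\<chi> (\<mu> k)) \<ge> 4 * (-1) ^ (n - k - 1) * Re \<beta>))"
proof -
  obtain m where m: "n = Suc (Suc (Suc m))"
    using n by (metis Suc_le_D numeral_3_eq_3 Suc_le_mono)
  define d where "d = (\<lambda>i. c (Suc i))"
  define w where "w = (\<lambda>i. (cmod (b (Suc i)))\<^sup>2)"
  have w_pos: "w i > 0" if "i < n" for i
    using b[of "Suc i"] that by (simp add: w_def)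
  have \<beta>_nonzero: "\<beta> \<noteq> 0"
    using b by (simp add: \<beta>)
  have cmod_\<beta>: "(cmod \<beta>)\<^sup>2 = (\<Prod>i<Suc m. w i) * w (Suc m) * w (Suc (Suc m))"
  proof -
    have "{1..n} = Suc ` {..<n}" by (simp add: image_Suc_lessThan)
    then have "\<beta> = (\<Prod>i<n. b (Suc i))" by (simp add: \<beta> prod.reindex)
    then have "(cmod \<beta>)\<^sup>2 = (\<Prod>i<n. w i)"
      by (simp add: prod_norm[symmetric] prod_power_distrib w_def)
    then show ?thesis by (simp add: m mult.assoc)
  qed
  have root: "poly (jacobi_poly d w (Suc (Suc m))) (\<mu> k) = 0" if "k \<in> {1..Suc (Suc m)}" for k
    unfolding d_def w_def
    by (rule block_eigenvalue_root[OF m, where a = a])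
       (use that \<mu>_eigenvalues in \<open>simp add: J m\<close>)
  \<comment> \<open>Here \<open>t\<close> is the sum of the two weighted corner minors, which have the common sign of the
    power of \<open>-1\<close>.\<close>
  have key: "\<exists>t. \<chi> (\<mu> k) = complex_of_real (- (t + 2 * Re \<beta>))
      \<and> 2 * cmod \<beta> \<le> (-1) ^ (n - k - 1) * t" if k: "k \<in> {1..n-1}" for k
  proof -
    let ?P = "poly (jacobi_poly d w (Suc m)) (\<mu> k)"
    let ?Q = "poly (jacobi_poly (\<lambda>i. d (Suc i)) (\<lambda>i. w (Suc i)) (Suc m)) (\<mu> k)"
    let ?y = "w (Suc m) * ?P" and ?z = "w (Suc (Suc m)) * ?Q"
    let ?s = "(-1) ^ (n - k - 1) :: real"
    have k': "k \<in> {1..Suc (Suc m)}" and inc: "strict_mono_on {1..Suc (Suc m)} \<mu>"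
      using k \<mu>_increasing by (simp_all add: m)
    have "?s * ?P > 0"
      using jacobi_poly_sign_at_next_roots[OF _ inc root k'] w_pos k by (simp add: m Suc_diff_le)
    then have y: "?s * ?y > 0"
      using w_pos[of "Suc m"] by (simp add: m mult.left_commute)
    have "?P * ?Q = (\<Prod>i<Suc m. w i)"
      using jacobi_poly_casoratian[of d w m "\<mu> k"] root[OF k'] by (simp del: jacobi_poly.simps)
    then have yz: "?y * ?z = (cmod \<beta>)\<^sup>2"
      by (simp only: cmod_\<beta> mult_ac)
    have s: "?s = 1 \<or> ?s = -1"
      by (cases "even (n - k - 1)") auto
    have "2 * cmod \<beta> \<le> ?s * (?y + ?z)"
      by (rule two_mult_le_add_of_prod_eq[OF s y yz]) (simp add: \<beta>_nonzero)
    moreover have "\<chi> (\<mu> k) = complex_of_real (- ((?y + ?z) + 2 * Re \<beta>))"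
    proof -
      have "\<chi> (\<mu> k) = (\<mu> k - a) * complex_of_real (poly (jacobi_poly d w (Suc (Suc m))) (\<mu> k))
          - complex_of_real (?z + ?y + 2 * Re \<beta>)"
        unfolding \<chi> J \<beta> d_def w_def by (rule periodic_jacobi_char_value[OF m])
      then show ?thesis
        unfolding root[OF k'] by (simp add: add_ac)
    qed
    ultimately show ?thesis by blast
  qed
  have bounds: "\<chi> (\<mu> k) \<in> \<real>
      \<and> (-1) ^ (n - k) * Re (\<chi> (\<mu> k)) \<ge> 2 * cmod \<beta> + 2 * ((-1) ^ (n - k - 1) * Re \<beta>)
      \<and> cmod (\<chi> (\<mu> k) + 2 * Re \<beta>) \<ge> 2 * cmod \<beta>" if k: "k \<in> {1..n-1}" for k
  proof -
    obtain t where t: "\<chi> (\<mu> k) = complex_of_real (- (t + 2 * Re \<beta>))"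
      and le: "2 * cmod \<beta> \<le> (-1) ^ (n - k - 1) * t"
      using key[OF k] by blast
    have "(-1 :: real) ^ (n - k) = (-1) ^ Suc (n - k - 1)"
      using k by (intro arg_cong[where f = "(^) (-1)"]) auto
    then have sign: "(-1) ^ (n - k) = - ((-1) ^ (n - k - 1) :: real)"
      by simp
    have "\<chi> (\<mu> k) + 2 * Re \<beta> = complex_of_real (- t)" by (simp add: t)
    then have "cmod (\<chi> (\<mu> k) + 2 * Re \<beta>) = \<bar>t\<bar>" by (simp only: norm_of_real abs_minus)
    also have "\<dots> = \<bar>(-1) ^ (n - k - 1) * t\<bar>" by (simp add: abs_mult)
    finally show ?thesis
      using le unfolding sign by (simp add: t algebra_simps)
  qed
  have alt: "\<bar>(-1) ^ (n - k - 1) * Re \<beta>\<bar> = \<bar>Re \<beta>\<bar>" for k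
    by (simp add: abs_mult)
  have strict: "\<bar>Re \<beta>\<bar> < cmod \<beta>" if "\<beta> \<notin> \<real>"
  proof -
    have "0 < (Im \<beta>)\<^sup>2" using that by (simp add: complex_is_Real_iff)
    then have "\<bar>Re \<beta>\<bar>\<^sup>2 < (cmod \<beta>)\<^sup>2" by (simp add: cmod_power2)
    then show ?thesis by (rule power2_less_imp_less) simp
  qed
  show ?thesis
  proof (intro conjI ballI impI)
    fix k assume k: "k \<in> {1..n-1}"
    show "\<chi> (\<mu> k) \<in> \<real>" using bounds[OF k] by blast
    show "(-1) ^ (n - k) * Re (\<chi> (\<mu> k)) > 0" if "\<beta> \<notin> \<real>"
      using bounds[OF k] strict[OF that] alt[of k] by linarith
    show "cmod (\<chi> (\<mu> k) + 2 * Re \<beta>) \<ge> 2 * cmod \<beta>" using bounds[OF k] by blast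
    show "(-1) ^ (n - k) * Re (\<chi> (\<mu> k)) \<ge> 0"
      using bounds[OF k] abs_Re_le_cmod[of \<beta>] alt[of k] by linarith
    have "\<bar>(-1) ^ (n - k) * Re (\<chi> (\<mu> k))\<bar> \<le> cmod (\<chi> (\<mu> k))"
      using abs_Re_le_cmod[of "\<chi> (\<mu> k)"] by (simp add: abs_mult)
    then show "cmod (\<chi> (\<mu> k)) \<ge> 4 * (-1) ^ (n - k - 1) * Re \<beta>"
      using bounds[OF k] abs_Re_le_cmod[of \<beta>] alt[of k] by linarith
  qed
qed

end
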